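(* Let $A\in\mathbb{R}^{m\times n}$, $m\ge n$, have full column rank, let $\mathbf{b}\in\mathbb{R}^m$, let $W\in\mathbb{R}^{m\times m}$ be symmetric positive definite, and let $L\in\mathbb{R}^{n\times k}$, $k\le n$. When the infinity norm is chosen on the solution space $\mathbb{R}^k$, the condition number $\mathcal{K}_\infty$ of the weighted least squares solution map $g(A,\mathbf{b})=L^{\mathrm T}(A^{\mathrm T}WA)^{-1}A^{\mathrm T}W\mathbf{b}$ at $(A,\mathbf{b})$ is $$\mathcal{K}_{\infty}=\Big\|\,|L^{\mathrm T}V|\,\mathrm{vec}(|A|)+|L^{\mathrm T}A_{W,I_n}^{\dagger}|\,|\mathbf{b}|\,\Big\|_{\infty},$$ where $V=(A^{\mathrm T}WA)^{-1}\otimes\mathbf{d}^{\mathrm T}-\mathbf{x}^{\mathrm T}\otimes A_{W,I_n}^{\dagger}$.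
   Context: Notation: $A_{W,I_n}^{\dagger}=(A^{\mathrm T}WA)^{-1}A^{\mathrm T}W$; $\mathbf{x}=A_{W,I_n}^{\dagger}\mathbf{b}$; $\mathbf{d}=W(\mathbf{b}-A\mathbf{x})$; $|\cdot|$ is the entrywise absolute value; $\mathrm{vec}$ stacks the columns of a matrix; $\otimes$ is the Kronecker product. Condition number: $W$ and $L$ are fixed and $g$ is a function of the data $(A,\mathbf{b})$. A perturbation $(\Delta A,\Delta\mathbf{b})\in\mathbb{R}^{m\times n}\times\mathbb{R}^m$ is admissible if each of its entries vanishes wherever the corresponding entry of $(A,\mathbf{b})$ vanishes. For admissible perturbations, $\|(\Delta A,\Delta\mathbf{b})\|_c=\min\{\omega:\ |\Delta A|\le\omega|A|,\ |\Delta\mathbf{b}|\le\omega|\mathbf{b}|\}$ (entrywise). Then $\mathcal{K}_\infty=\max\{\|g'(A,\mathbf{b})\cdot(\Delta A,\Delta\mathbf{b})\|_\infty:\ (\Delta A,\Delta\mathbf{b})\text{ admissible},\ \|(\Delta A,\Delta\mathbf{b})\|_c=1\}$, where $g'$ is the Fréchet derivative. *)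

theory Defs
  imports "HOL-Analysis.Analysis"
begin

text \<open>
  On vectors and matrices of type \<open>real ^ 'n\<close> and \<open>real ^ 'n ^ 'm\<close>, the library's
  \<open>\<bar>_\<bar>\<close> and \<open>\<le>\<close> are entrywise, and \<open>infnorm\<close> is the maximum norm.
\<close>

definition sym_pos_def :: "real ^ 'm ^ 'm \<Rightarrow> bool" where
  "sym_pos_def W \<longleftrightarrow> transpose W = W \<and> (\<forall>v. v \<noteq> 0 \<longrightarrow> v \<bullet> (W *v v) > 0)"

text \<open>
  Pairs of indices, ordered lexicographically, index the rows and columns of a Kronecker
  product. Accordingly \<open>vec_cols M\<close> has entry \<open>M\<^sub>i\<^sub>j\<close> at index \<open>(j, i)\<close>, column index first,
  which is the stacking of columns.
\<close>

definition kronecker :: "real ^ 'b ^ 'a \<Rightarrow> real ^ 'd ^ 'c \<Rightarrow> real ^ ('b \<times> 'd) ^ ('a \<times> 'c)" where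
  "kronecker M N = (\<chi> r c. M $ fst r $ fst c * N $ snd r $ snd c)"

definition vec_cols :: "real ^ 'n ^ 'm \<Rightarrow> real ^ ('n \<times> 'm)" where
  "vec_cols M = (\<chi> p. M $ snd p $ fst p)"

text \<open>
  When one factor of a Kronecker product has a single row (row type \<open>1\<close>), the row types
  \<open>'a \<times> 1\<close> and \<open>1 \<times> 'a\<close> of the product are identified with \<open>'a\<close>.
\<close>

definition drop_unit_right :: "real ^ 'c ^ ('a \<times> 1) \<Rightarrow> real ^ 'c ^ 'a" where
  "drop_unit_right M = (\<chi> r. M $ (r, 1))"

definition drop_unit_left :: "real ^ 'c ^ (1 \<times> 'a) \<Rightarrow> real ^ 'c ^ 'a" where
  "drop_unit_left M = (\<chi> r. M $ (1, r))"

definition wls_pinv :: "real ^ 'm ^ 'm \<Rightarrow> real ^ 'n ^ 'm \<Rightarrow> real ^ 'm ^ 'n" where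
  "wls_pinv W A = matrix_inv (transpose A ** W ** A) ** transpose A ** W"

definition wls_sol :: "real ^ 'm ^ 'm \<Rightarrow> real ^ 'n ^ 'm \<Rightarrow> real ^ 'm \<Rightarrow> real ^ 'n" where
  "wls_sol W A b = wls_pinv W A *v b"

definition wls_resid :: "real ^ 'm ^ 'm \<Rightarrow> real ^ 'n ^ 'm \<Rightarrow> real ^ 'm \<Rightarrow> real ^ 'm" where
  "wls_resid W A b = W *v (b - A *v wls_sol W A b)"

definition wls_map ::
    "real ^ 'm ^ 'm \<Rightarrow> real ^ 'k ^ 'n \<Rightarrow> (real ^ 'n ^ 'm) \<times> (real ^ 'm) \<Rightarrow> real ^ 'k" where
  "wls_map W L = (\<lambda>(A, b).
     (transpose L ** matrix_inv (transpose A ** W ** A) ** transpose A ** W) *v b)"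

definition wls_V :: "real ^ 'm ^ 'm \<Rightarrow> real ^ 'n ^ 'm \<Rightarrow> real ^ 'm \<Rightarrow> real ^ ('n \<times> 'm) ^ 'n" where
  "wls_V W A b =
     drop_unit_right (kronecker (matrix_inv (transpose A ** W ** A))
       (rowvector (wls_resid W A b) :: real ^ 'm ^ 1)) -
     drop_unit_left (kronecker (rowvector (wls_sol W A b) :: real ^ 'n ^ 1) (wls_pinv W A))"

definition admissible ::
    "(real ^ 'n ^ 'm) \<times> (real ^ 'm) \<Rightarrow> (real ^ 'n ^ 'm) \<times> (real ^ 'm) \<Rightarrow> bool" where
  "admissible = (\<lambda>(A, b) (dA, db).
     (\<forall>i j. A $ i $ j = 0 \<longrightarrow> dA $ i $ j = 0) \<and> (\<forall>i. b $ i = 0 \<longrightarrow> db $ i = 0))"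

text \<open>
  The minimum below exists if the perturbation is admissible and the data \<open>(A, b)\<close> are not
  all zero; otherwise the value is unspecified.
\<close>

definition norm_c ::
    "(real ^ 'n ^ 'm) \<times> (real ^ 'm) \<Rightarrow> (real ^ 'n ^ 'm) \<times> (real ^ 'm) \<Rightarrow> real" where
  "norm_c = (\<lambda>(A, b) (dA, db). LEAST w. \<bar>dA\<bar> \<le> w *\<^sub>R \<bar>A\<bar> \<and> \<bar>db\<bar> \<le> w *\<^sub>R \<bar>b\<bar>)"

text \<open>
  \<open>GREATEST\<close> is the maximum, not a supremum: its value is determined only if it is attained.
\<close>

definition cond_inf ::
    "((real ^ 'n ^ 'm) \<times> (real ^ 'm) \<Rightarrow> real ^ 'k) \<Rightarrow> (real ^ 'n ^ 'm) \<times> (real ^ 'm) \<Rightarrow> real" where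
  "cond_inf g D = (GREATEST r. \<exists>P. admissible D P \<and> norm_c D P = 1 \<and>
     r = infnorm (frechet_derivative g (at D) P))"

end

theory Submission
  imports Defs
begin

text \<open>
  The solution \<open>x\<close> solves the normal equations \<open>(A\<^sup>T W A) x = A\<^sup>T W b\<close>. Differentiating both
  sides and collecting terms around the residual \<open>d = W (b - A x)\<close> gives
  \<open>dx = (A\<^sup>T W A)\<^sup>-\<^sup>1 dA\<^sup>T d - A\<^sup>\<dagger> dA x + A\<^sup>\<dagger> db\<close>, with \<open>A\<^sup>\<dagger>\<close> the weighted pseudoinverse. The first
  two terms are linear in the entries of \<open>dA\<close>, and \<open>V\<close> is the matrix of their coefficients, so that
  \<open>g'(A, b)\<close> sends \<open>(dA, db)\<close> to \<open>L\<^sup>T V vec(dA) + L\<^sup>T A\<^sup>\<dagger> db\<close> (\<open>has_derivative_wls_map\<close>).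

  The rest holds for every map whose derivative has the form \<open>K vec(dA) + N db\<close>
  (\<open>cond_inf_of_derivative\<close>). A perturbation of componentwise norm 1 has entries bounded by those
  of \<open>\<bar>A\<bar>\<close> and \<open>\<bar>b\<bar>\<close>, so by the triangle inequality row \<open>r\<close> of the image is at most row \<open>r\<close> of
  \<open>\<bar>K\<bar> vec(\<bar>A\<bar>) + \<bar>N\<bar> \<bar>b\<bar>\<close> in absolute value. For a row where this vector is largest, giving the
  entries of \<open>\<bar>A\<bar>\<close> and \<open>\<bar>b\<bar>\<close> the signs of the coefficients in that row makes all terms of the sum
  nonnegative and turns the estimate into an equality, so the maximum is attained.
\<close>

text \<open>
  The normal equations are manipulated with explicit transposes, whereas the library's simplifier
  setup replaces them by row-vector products.
\<close>

declare transpose_matrix_vector [simp del]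

lemma bounded_bilinear_matrix_vector_mult:
  "bounded_bilinear ((*v) :: real ^ 'n ^ 'm \<Rightarrow> real ^ 'n \<Rightarrow> real ^ 'm)"
  unfolding bilinear_conv_bounded_bilinear [symmetric] bilinear_def
  by (auto intro!: linearI simp: algebra_simps scaleR_matrix_vector_assoc)

lemma bounded_bilinear_matrix_matrix_mult:
  "bounded_bilinear ((**) :: real ^ 'n ^ 'm \<Rightarrow> real ^ 'k ^ 'n \<Rightarrow> real ^ 'k ^ 'm)"
  unfolding bilinear_conv_bounded_bilinear [symmetric] bilinear_def
  by (auto intro!: linearI simp: matrix_add_ldistrib matrix_scalar_ac scalar_matrix_assoc vec_eq_iff
      matrix_matrix_mult_def sum_distrib_left sum.distrib algebra_simps)

lemma bounded_linear_transpose: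
  "bounded_linear (transpose :: real ^ 'n ^ 'm \<Rightarrow> real ^ 'm ^ 'n)"
  by (intro linear_conv_bounded_linear[THEN iffD1] linearI) (simp_all add: transpose_def vec_eq_iff)

lemmas has_derivative_matrix_vector_mult [derivative_intros] =
  bounded_bilinear.FDERIV [OF bounded_bilinear_matrix_vector_mult]
lemmas has_derivative_matrix_matrix_mult [derivative_intros] =
  bounded_bilinear.FDERIV [OF bounded_bilinear_matrix_matrix_mult]
lemmas has_derivative_transpose [derivative_intros] =
  bounded_linear.has_derivative [OF bounded_linear_transpose]

lemma matrix_inv_mult_left: "invertible M \<Longrightarrow> matrix_inv M ** M = mat 1"
  and matrix_inv_mult_right: "invertible M \<Longrightarrow> M ** matrix_inv M = mat 1"
  for M :: "real ^ 'n ^ 'n"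
  unfolding invertible_def matrix_inv_def by (metis (mono_tags, lifting) someI_ex)+

lemma open_invertible: "open {M :: real ^ 'n ^ 'n. invertible M}"
proof -
  have "continuous_on UNIV (det :: real ^ 'n ^ 'n \<Rightarrow> real)"
    unfolding det_def by (intro continuous_intros)
  then have "open {M :: real ^ 'n ^ 'n. det M \<noteq> 0}"
    by (intro open_Collect_neq continuous_intros)
  then show ?thesis
    by (simp add: invertible_det_nz)
qed

text \<open>
  Solving a linear system is inverse to the polynomial map \<open>(M, x) \<mapsto> (M, M x)\<close>. The component \<open>M\<close>
  is carried along to make source and target the same space, so that the inverse function theorem
  applies; inverting the derivative \<open>(dM, dx) \<mapsto> (dM, M dx + dM x)\<close> gives the formula below.
\<close>

lemma has_derivative_linear_solve:
  fixes M :: "real ^ 'n ^ 'n" and c :: "real ^ 'n"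
  assumes "invertible M"
  shows "((\<lambda>p. matrix_inv (fst p) *v snd p) has_derivative
    (\<lambda>h. matrix_inv M *v (snd h - fst h *v (matrix_inv M *v c)))) (at (M, c))"
proof -
  define x where "x = matrix_inv M *v c"
  define f where "f = (\<lambda>p :: (real ^ 'n ^ 'n) \<times> (real ^ 'n). (fst p, fst p *v snd p))"
  define f' where "f' = (\<lambda>h :: (real ^ 'n ^ 'n) \<times> (real ^ 'n). (fst h, M *v snd h + fst h *v x))"
  define g where "g = (\<lambda>p :: (real ^ 'n ^ 'n) \<times> (real ^ 'n). (fst p, matrix_inv (fst p) *v snd p))"
  define g' where "g' = (\<lambda>h :: (real ^ 'n ^ 'n) \<times> (real ^ 'n).
      (fst h, matrix_inv M *v (snd h - fst h *v x)))"
  define S where "S = {M :: real ^ 'n ^ 'n. invertible M} \<times> (UNIV :: (real ^ 'n) set)"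
  have fx: "f (M, x) = (M, c)"
    by (simp add: f_def x_def matrix_vector_mul_assoc matrix_inv_mult_right assms)
  have "(g has_derivative g') (at (f (M, x)))"
  proof (rule has_derivative_inverse_strong [where f = f and x = "(M, x)"])
    show "open S"
      unfolding S_def by (intro open_Times open_invertible open_UNIV)
    show "(M, x) \<in> S"
      using assms by (simp add: S_def)
    show "continuous_on S f"
      unfolding f_def
      by (intro continuous_intros bounded_bilinear.continuous_on [OF bounded_bilinear_matrix_vector_mult])
    show "g (f p) = p" if "p \<in> S" for p
      using that by (auto simp: S_def f_def g_def matrix_vector_mul_assoc matrix_inv_mult_left)
    show "(f has_derivative f') (at (M, x))"
      unfolding f_def f'_def by (auto intro!: derivative_eq_intros)
    show "f' \<circ> g' = id"
      by (auto simp: f'_def g'_def fun_eq_iff matrix_vector_mul_assoc matrix_inv_mult_right assms)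
  qed
  from has_derivative_snd [OF this [unfolded fx]] show ?thesis
    by (simp add: g_def g'_def x_def)
qed

text \<open>
  The quadratic form of \<open>A\<^sup>T W A\<close> at \<open>v\<close> is that of \<open>W\<close> at \<open>A v\<close>, hence the kernel is that of \<open>A\<close>.
\<close>

lemma invertible_normal_matrix:
  fixes A :: "real ^ 'n ^ 'm" and W :: "real ^ 'm ^ 'm"
  assumes "rank A = CARD('n)" and "sym_pos_def W"
  shows "invertible (transpose A ** W ** A)"
proof -
  have "v = 0" if "(transpose A ** W ** A) *v v = 0" for v
  proof -
    have "(A *v v) \<bullet> (W *v (A *v v)) = v \<bullet> ((transpose A ** W ** A) *v v)"
      by (simp add: dot_lmul_matrix [symmetric] matrix_vector_mul_assoc [symmetric])
    then have "A *v v = 0"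
      using that assms(2) by (force simp: sym_pos_def_def)
    then show "v = 0"
      using assms(1) by (metis full_rank_injective injD matrix_vector_mult_0_right)
  qed
  then show ?thesis
    by (simp add: invertible_left_inverse matrix_left_invertible_ker)
qed

text \<open>
  This undoes the vectorisation: a Kronecker product applied to \<open>vec(D)\<close> is a product of three
  matrices with \<open>D\<close> (or its transpose) in the middle, which is how \<open>D\<close> enters when the normal
  equations are differentiated.
\<close>

lemma wls_V_mult_vec_cols:
  fixes A D :: "real ^ 'n ^ 'm" and b :: "real ^ 'm"
  shows "wls_V W A b *v vec_cols D =
    matrix_inv (transpose A ** W ** A) *v (transpose D *v wls_resid W A b) -
    wls_pinv W A *v (D *v wls_sol W A b)"
proof -
  have "(\<Sum>p\<in>UNIV. (G $ r $ fst p * d $ snd p - x $ fst p * P $ r $ snd p) * D $ snd p $ fst p) =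
      (\<Sum>j\<in>UNIV. G $ r $ j * (\<Sum>i\<in>UNIV. D $ i $ j * d $ i)) -
      (\<Sum>i\<in>UNIV. P $ r $ i * (\<Sum>j\<in>UNIV. D $ i $ j * x $ j))"
    for G :: "real ^ 'n ^ 'n" and d :: "real ^ 'm" and x :: "real ^ 'n" and P :: "real ^ 'm ^ 'n" and r
  proof -
    have "(\<Sum>i\<in>UNIV. P $ r $ i * (\<Sum>j\<in>UNIV. D $ i $ j * x $ j)) =
        (\<Sum>j\<in>UNIV. \<Sum>i\<in>UNIV. P $ r $ i * (D $ i $ j * x $ j))"
      unfolding sum_distrib_left by (rule sum.swap)
    then show ?thesis
      by (simp add: UNIV_Times_UNIV [symmetric] sum.cartesian_product' sum_distrib_left
          sum_subtractf [symmetric] algebra_simps del: UNIV_Times_UNIV)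
  qed
  then show ?thesis
    by (simp add: vec_eq_iff wls_V_def vec_cols_def matrix_vector_mult_def kronecker_def
        drop_unit_left_def drop_unit_right_def rowvector_def transpose_def)
qed

lemma has_derivative_wls_map:
  fixes A :: "real ^ 'n ^ 'm" and b :: "real ^ 'm"
    and W :: "real ^ 'm ^ 'm" and L :: "real ^ 'k ^ 'n"
  assumes inv: "invertible (transpose A ** W ** A)"
  shows "(wls_map W L has_derivative (\<lambda>h. (transpose L ** wls_V W A b) *v vec_cols (fst h) +
    (transpose L ** wls_pinv W A) *v snd h)) (at (A, b))"
proof -
  define M where "M = transpose A ** W ** A"
  define x where "x = wls_sol W A b"
  have map_eq: "wls_map W L = (\<lambda>p. transpose L *v
      (matrix_inv (transpose (fst p) ** W ** fst p) *v (transpose (fst p) *v (W *v snd p))))"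
    by (auto simp: wls_map_def matrix_vector_mul_assoc matrix_mul_assoc)
  have x_eq: "matrix_inv M *v (transpose A *v (W *v b)) = x"
    by (simp add: x_def M_def wls_sol_def wls_pinv_def matrix_vector_mul_assoc matrix_mul_assoc)
  \<comment> \<open>\<open>N\<close> maps the data to the matrix and the right-hand side of the normal equations.\<close>
  define N where "N = (\<lambda>p :: (real ^ 'n ^ 'm) \<times> (real ^ 'm).
      (transpose (fst p) ** W ** fst p, transpose (fst p) *v (W *v snd p)))"
  define N' where "N' = (\<lambda>h :: (real ^ 'n ^ 'm) \<times> (real ^ 'm).
      (transpose A ** W ** fst h + transpose (fst h) ** W ** A,
       transpose A *v (W *v snd h) + transpose (fst h) *v (W *v b)))"
  have N: "(N has_derivative N') (at (A, b))"
    unfolding N_def N'_def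
    by (auto intro!: derivative_eq_intros)
  have solve: "((\<lambda>p. matrix_inv (fst p) *v snd p) has_derivative
      (\<lambda>h. matrix_inv M *v (snd h - fst h *v x))) (at (N (A, b)))"
    using has_derivative_linear_solve [of M "transpose A *v (W *v b)"] inv x_eq
    by (simp add: N_def M_def)
  have "(wls_map W L has_derivative
      (\<lambda>h. transpose L *v (matrix_inv M *v (snd (N' h) - fst (N' h) *v x)))) (at (A, b))"
    using bounded_linear.has_derivative
      [OF matrix_vector_mul_bounded_linear [of "transpose L"] diff_chain_at [OF N solve]]
    by (simp add: map_eq N_def o_def)
  \<comment> \<open>The terms with \<open>dA\<^sup>T\<close> combine to \<open>dA\<^sup>T W (b - A x)\<close>, which is where the residual comes from.\<close>
  moreover have "matrix_inv M *v (snd (N' h) - fst (N' h) *v x) =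
      wls_V W A b *v vec_cols (fst h) + wls_pinv W A *v snd h" for h
    unfolding wls_V_mult_vec_cols
    by (simp add: N'_def M_def wls_pinv_def wls_resid_def x_def [symmetric]
        matrix_vector_mul_assoc [symmetric] algebra_simps)
  ultimately show ?thesis
    by (simp add: matrix_vector_mul_assoc [symmetric] algebra_simps)
qed

text \<open>
  The least \<open>w\<close> is the largest of the ratios of corresponding entries. With division by zero giving
  zero, an entry that vanishes in the data contributes the ratio \<open>0\<close>; this is harmless
  since some entry of \<open>A\<close> is nonzero, which already forces \<open>w \<ge> 0\<close>.
\<close>

lemma norm_c_attained:
  fixes A D :: "real ^ 'n ^ 'm" and b e :: "real ^ 'm"
  assumes adm: "admissible (A, b) (D, e)" and "A \<noteq> 0"
  shows "\<bar>D\<bar> \<le> norm_c (A, b) (D, e) *\<^sub>R \<bar>A\<bar> \<and> \<bar>e\<bar> \<le> norm_c (A, b) (D, e) *\<^sub>R \<bar>b\<bar>"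
proof -
  define R where "R = (\<lambda>(i, j). \<bar>D $ i $ j\<bar> / \<bar>A $ i $ j\<bar>) ` UNIV \<union> (\<lambda>i. \<bar>e $ i\<bar> / \<bar>b $ i\<bar>) ` UNIV"
  have R: "finite R" "R \<noteq> {}"
    by (auto simp: R_def)
  have le_iff: "\<bar>D\<bar> \<le> w *\<^sub>R \<bar>A\<bar> \<and> \<bar>e\<bar> \<le> w *\<^sub>R \<bar>b\<bar> \<longleftrightarrow>
      (\<forall>i j. \<bar>D $ i $ j\<bar> \<le> w * \<bar>A $ i $ j\<bar>) \<and> (\<forall>i. \<bar>e $ i\<bar> \<le> w * \<bar>b $ i\<bar>)" for w
    by (simp add: less_eq_vec_def abs_vec_def)
  have ratio: "\<bar>D $ i $ j\<bar> / \<bar>A $ i $ j\<bar> \<le> Max R" "\<bar>e $ i\<bar> / \<bar>b $ i\<bar> \<le> Max R" for i j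
    using R by (auto simp: R_def intro!: Max_ge)
  have "\<bar>D $ i $ j\<bar> \<le> Max R * \<bar>A $ i $ j\<bar>" for i j
    using ratio(1)[of i j] adm by (cases "A $ i $ j = 0") (auto simp: admissible_def field_simps)
  moreover have "\<bar>e $ i\<bar> \<le> Max R * \<bar>b $ i\<bar>" for i
    using ratio(2)[of i] adm by (cases "b $ i = 0") (auto simp: admissible_def field_simps)
  ultimately have Max_R: "(\<forall>i j. \<bar>D $ i $ j\<bar> \<le> Max R * \<bar>A $ i $ j\<bar>) \<and> (\<forall>i. \<bar>e $ i\<bar> \<le> Max R * \<bar>b $ i\<bar>)"
    by blast
  have "norm_c (A, b) (D, e) = Max R"
    unfolding norm_c_def prod.case le_iff
  proof (rule Least_equality)
    show "(\<forall>i j. \<bar>D $ i $ j\<bar> \<le> Max R * \<bar>A $ i $ j\<bar>) \<and> (\<forall>i. \<bar>e $ i\<bar> \<le> Max R * \<bar>b $ i\<bar>)"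
      by (rule Max_R)
  next
    fix w
    assume w: "(\<forall>i j. \<bar>D $ i $ j\<bar> \<le> w * \<bar>A $ i $ j\<bar>) \<and> (\<forall>i. \<bar>e $ i\<bar> \<le> w * \<bar>b $ i\<bar>)"
    obtain i j where "A $ i $ j \<noteq> 0"
      using \<open>A \<noteq> 0\<close> by (auto simp: vec_eq_iff)
    moreover have "0 \<le> w * \<bar>A $ i $ j\<bar>"
      using w abs_ge_zero order_trans by blast
    ultimately have "0 \<le> w"
      by (simp add: zero_le_mult_iff)
    have "r \<le> w" if "r \<in> R" for r
      using that w \<open>0 \<le> w\<close> unfolding R_def
      by (auto simp: divide_le_eq)
    then show "Max R \<le> w"
      using R by simp
  qed
  with Max_R show ?thesis
    by (simp add: le_iff)
qed

lemma norm_c_signed_data: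
  fixes A D :: "real ^ 'n ^ 'm" and b e :: "real ^ 'm"
  assumes "\<bar>D\<bar> = \<bar>A\<bar>" "\<bar>e\<bar> = \<bar>b\<bar>" and "A \<noteq> 0"
  shows "norm_c (A, b) (D, e) = 1"
  unfolding norm_c_def prod.case assms
proof (rule Least_equality)
  fix w
  assume w: "\<bar>A\<bar> \<le> w *\<^sub>R \<bar>A\<bar> \<and> \<bar>b\<bar> \<le> w *\<^sub>R \<bar>b\<bar>"
  obtain i j where "A $ i $ j \<noteq> 0"
    using \<open>A \<noteq> 0\<close> by (auto simp: vec_eq_iff)
  moreover have "\<bar>A $ i $ j\<bar> \<le> w * \<bar>A $ i $ j\<bar>"
    using w by (simp add: less_eq_vec_def abs_vec_def)
  ultimately show "1 \<le> w"
    by simp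
qed simp

lemma infnorm_attained_cart: "\<exists>r. infnorm x = \<bar>x $ r\<bar>" for x :: "real ^ 'n"
proof -
  have "infnorm x \<in> range (\<lambda>i. \<bar>x $ i\<bar>)"
    unfolding infnorm_cart by (auto simp: full_SetCompr_eq cSup_eq_Max intro!: Max_in)
  then show ?thesis by auto
qed

text \<open>
  Over the box \<open>\<bar>dA\<bar> \<le> \<bar>A\<bar>\<close>, \<open>\<bar>db\<bar> \<le> \<bar>b\<bar>\<close>, each row of a linear map is maximal at the corner where the
  signs agree with the coefficients of the row. All corners have componentwise norm exactly 1, so
  restricting to norm 1 does not lower the maximum.
\<close>

theorem cond_inf_of_derivative:
  fixes A :: "real ^ 'n ^ 'm" and b :: "real ^ 'm"
    and K :: "real ^ ('n \<times> 'm) ^ 'k" and N :: "real ^ 'm ^ 'k"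
  assumes der: "(g has_derivative (\<lambda>h. K *v vec_cols (fst h) + N *v snd h)) (at (A, b))"
    and "A \<noteq> 0"
  shows "cond_inf g (A, b) = infnorm (\<bar>K\<bar> *v vec_cols \<bar>A\<bar> + \<bar>N\<bar> *v \<bar>b\<bar>)"
proof -
  define u where "u = \<bar>K\<bar> *v vec_cols \<bar>A\<bar> + \<bar>N\<bar> *v \<bar>b\<bar>"
  have u: "u $ r = (\<Sum>p\<in>UNIV. \<bar>K $ r $ p\<bar> * \<bar>A $ snd p $ fst p\<bar>) + (\<Sum>i\<in>UNIV. \<bar>N $ r $ i\<bar> * \<bar>b $ i\<bar>)" for r
    by (simp add: u_def matrix_vector_mult_def vec_cols_def abs_vec_def)
  have u_nonneg: "0 \<le> u $ r" for r
    unfolding u by (intro add_nonneg_nonneg sum_nonneg) auto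
  have fd: "frechet_derivative g (at (A, b)) (D, e) $ r =
      (\<Sum>p\<in>UNIV. K $ r $ p * D $ snd p $ fst p) + (\<Sum>i\<in>UNIV. N $ r $ i * e $ i)" for D e r
    by (simp add: frechet_derivative_at [OF der, symmetric] matrix_vector_mult_def vec_cols_def)
  have upper: "infnorm (frechet_derivative g (at (A, b)) (D, e)) \<le> infnorm u"
    if adm: "admissible (A, b) (D, e)" and "norm_c (A, b) (D, e) = 1" for D e
  proof -
    have le: "\<bar>D $ i $ j\<bar> \<le> \<bar>A $ i $ j\<bar>" "\<bar>e $ i\<bar> \<le> \<bar>b $ i\<bar>" for i j
      using norm_c_attained [OF adm \<open>A \<noteq> 0\<close>] that by (auto simp: less_eq_vec_def abs_vec_def)
    obtain r where r: "infnorm (frechet_derivative g (at (A, b)) (D, e)) =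
        \<bar>frechet_derivative g (at (A, b)) (D, e) $ r\<bar>"
      using infnorm_attained_cart by blast
    also have "\<dots> \<le> u $ r"
      unfolding fd u
      by (intro order_trans [OF abs_triangle_ineq] add_mono order_trans [OF sum_abs] sum_mono)
        (auto simp: abs_mult intro!: mult_left_mono le)
    also have "\<dots> \<le> infnorm u"
      using component_le_infnorm_cart[of u r] by linarith
    finally show ?thesis .
  qed
  obtain r where r: "infnorm u = u $ r"
    using infnorm_attained_cart[of u] u_nonneg by auto
  \<comment> \<open>Unlike \<open>sgn\<close>, the sign of \<open>0\<close> is \<open>1\<close>: the perturbation must keep all absolute values of the data.\<close>
  define \<sigma> where "\<sigma> = (\<lambda>t :: real. if t < 0 then - 1 else 1 :: real)"
  have \<sigma>: "t * (\<sigma> t * s) = \<bar>t\<bar> * s" "\<bar>\<sigma> t\<bar> = 1" for s t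
    by (auto simp: \<sigma>_def)
  define D where "D = (\<chi> i j. \<sigma> (K $ r $ (j, i)) * \<bar>A $ i $ j\<bar>)"
  define e where "e = (\<chi> i. \<sigma> (N $ r $ i) * \<bar>b $ i\<bar>)"
  have adm: "admissible (A, b) (D, e)"
    by (simp add: admissible_def D_def e_def)
  have nc: "norm_c (A, b) (D, e) = 1"
    by (rule norm_c_signed_data [OF _ _ \<open>A \<noteq> 0\<close>])
      (simp_all add: D_def e_def vec_eq_iff abs_vec_def abs_mult \<sigma>)
  have "frechet_derivative g (at (A, b)) (D, e) $ r = u $ r"
    unfolding fd u by (simp add: D_def e_def \<sigma>)
  then have "infnorm u \<le> infnorm (frechet_derivative g (at (A, b)) (D, e))"
    using r component_le_infnorm_cart[of "frechet_derivative g (at (A, b)) (D, e)" r] by simp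
  with upper [OF adm nc] have "infnorm u = infnorm (frechet_derivative g (at (A, b)) (D, e))"
    by simp
  then have "cond_inf g (A, b) = infnorm u"
    unfolding cond_inf_def using adm nc upper
    by (intro Greatest_equality) auto
  then show ?thesis
    by (simp add: u_def)
qed

theorem corollary6:
  fixes A :: "real ^ 'n ^ 'm" and b :: "real ^ 'm"
    and W :: "real ^ 'm ^ 'm" and L :: "real ^ 'k ^ 'n"
  assumes "CARD('n) \<le> CARD('m)"
    and "rank A = CARD('n)"
    and "sym_pos_def W"
    and "CARD('k) \<le> CARD('n)"
  shows "cond_inf (wls_map W L) (A, b) =
    infnorm (\<bar>transpose L ** wls_V W A b\<bar> *v vec_cols \<bar>A\<bar> +
             \<bar>transpose L ** wls_pinv W A\<bar> *v \<bar>b\<bar>)"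
proof (rule cond_inf_of_derivative)
  show "A \<noteq> 0"
    using assms(2) rank_eq_0 [of A] by auto
qed (intro has_derivative_wls_map invertible_normal_matrix assms)

end
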